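(* Let $f$ be a Schwarz-Christoffel mapping of the unit disk $\mathbb{D}$ onto the interior of an $(n+1)$-gon, given by $$\frac{f''}{f'}(z)=\frac{2B_1(z)/B_2(z)}{1-zB_1(z)/B_2(z)},$$ where $B_1,B_2$ are finite Blaschke products without common zeros, of respective degrees $d_1,d_2$ with $d_1+d_2=n$, and suppose that $d_2\geq 1$. Suppose that all the zeros of $B_1,B_2$ are contained in the subdisk $|z|\leq r<1$. Then $$r\ \geq\ \max\left\{\frac{\sqrt{4d_1d_2+9}+3-2d_2}{\sqrt{4d_1d_2+9}+3+2d_2}\,,\ \frac{2d_2-1-\sqrt{1+4d_1d_2}}{2d_2+1+\sqrt{1+4d_1d_2}}\right\}.$$ In particular, if $d_2=1$ then $$r\ \geq\ \frac{\sqrt{4n+5}+1}{\sqrt{4n+5}+5}\ \geq\ \frac12 .$$ The last estimate is sharp for the Koebe function $k(z)=z/(1-z)^2$ (for which $n=1$, $d_1=0$, $d_2=1$): there equality holds with $r=\frac12$.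
   Context: $\mathbb{D}=\{|z|<1\}$. A Schwarz-Christoffel mapping onto the interior of an $(n+1)$-gon is an (analytic) conformal, hence univalent, map $f$ of $\mathbb{D}$ onto a domain whose boundary consists of finitely many line segments, rays or lines, with $n+1$ vertices (vertices at infinity are allowed). It satisfies $$\frac{f''}{f'}(z)=-2\sum_{k=1}^{n+1}\frac{\beta_k}{z-z_k},\qquad \sum_{k=1}^{n+1}\beta_k=1,$$ where the distinct points $z_k\in\partial\mathbb{D}$ are the pre-vertices and $2\pi\beta_k\ne 0$ are the exterior angles, $2\pi\beta_k=\pi-\alpha_k$, with $\alpha_k$ the interior angle at the vertex $f(z_k)$ (at a vertex at infinity $\alpha_k$ is minus the angle between the continuations of the relevant sides at a finite point). It is known that $f''/f'$ always has the stated representation in terms of finite Blaschke products. A finite Blaschke product of degree $d$ is a function $c\prod_{k=1}^{d}\frac{z-a_k}{1-\overline{a_k}z}$ with $|c|=1$ and all $|a_k|<1$ (a unimodular constant if $d=0$). *)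

theory Defs
  imports "HOL-Complex_Analysis.Complex_Analysis"
begin

definition finite_blaschke_product :: "(complex \<Rightarrow> complex) \<Rightarrow> nat \<Rightarrow> bool" where
  "finite_blaschke_product B d \<longleftrightarrow>
     (\<exists>c a. cmod c = 1 \<and> (\<forall>k\<in>{1..d}. cmod (a k) < 1) \<and>
        (\<forall>z\<in>ball 0 1. B z = c * (\<Prod>k=1..d. (z - a k) / (1 - cnj (a k) * z))))"

text \<open>
  Only the values on the open unit disk matter. There no factor has a vanishing denominator,
  and all zeros of a finite Blaschke product lie there.
\<close>

definition blaschke_zeros :: "(complex \<Rightarrow> complex) \<Rightarrow> complex set" where
  "blaschke_zeros B = {z \<in> ball 0 1. B z = 0}"

definition is_ray :: "complex set \<Rightarrow> bool" where
  "is_ray S \<longleftrightarrow> (\<exists>p v. v \<noteq> 0 \<and> S = {p + of_real t * v |t. 0 \<le> t})"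

definition is_line :: "complex set \<Rightarrow> bool" where
  "is_line S \<longleftrightarrow> (\<exists>p v. v \<noteq> 0 \<and> S = {p + of_real t * v |t. True})"

definition is_segment :: "complex set \<Rightarrow> bool" where
  "is_segment S \<longleftrightarrow> (\<exists>p q. p \<noteq> q \<and> S = closed_segment p q)"

definition polygonal_boundary :: "complex set \<Rightarrow> bool" where
  "polygonal_boundary G \<longleftrightarrow>
     (\<exists>\<S>. finite \<S> \<and> (\<forall>S\<in>\<S>. is_segment S \<or> is_ray S \<or> is_line S) \<and> frontier G = \<Union>\<S>)"

text \<open>
  The opening of the image domain at the boundary point (prime end) that corresponds to the
  point \<open>\<zeta>\<close> of the unit circle, seen from \<open>w\<close>. It is the length of the set of directions
  \<open>\<theta>\<close> such that the points \<open>w + \<rho> e\<^sup>i\<^sup>\<theta>\<close> are eventually in the image and their preimages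
  tend to \<open>\<zeta>\<close>. Here \<open>\<rho>\<close> runs along \<open>F\<close>: \<open>at_right 0\<close> for a vertex at the finite point \<open>w\<close>,
  \<open>at_top\<close> for a vertex at infinity. In the latter case the choice of \<open>w\<close> is
  irrelevant for a polygonal domain, and the opening is the angle formed by the two sides going
  to infinity (0 or \<open>2 * pi\<close> for sides parallel in the same direction, according to whether
  the domain lies between or around them). The condition on preimages is needed because several
  corners of the domain may sit at the same point, for instance on the two sides of a slit.
\<close>

definition opening_angle ::
  "(complex \<Rightarrow> complex) \<Rightarrow> complex \<Rightarrow> complex \<Rightarrow> real filter \<Rightarrow> real" where
  "opening_angle f \<zeta> w F =
     measure lebesgue
       {\<theta>\<in>{0..<2 * pi}.
          (\<forall>\<^sub>F \<rho> in F. w + of_real \<rho> * cis \<theta> \<in> f ` ball 0 1) \<and>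
          ((\<lambda>\<rho>. inv_into (ball 0 1) f (w + of_real \<rho> * cis \<theta>)) \<longlongrightarrow> \<zeta>) F}"

text \<open>
  \<open>\<alpha>\<close> is the interior angle at the vertex \<open>f(\<zeta>)\<close>, which is a finite point or infinity; at
  infinity the interior angle is minus the opening.
\<close>

definition has_interior_angle :: "(complex \<Rightarrow> complex) \<Rightarrow> complex \<Rightarrow> real \<Rightarrow> bool" where
  "has_interior_angle f \<zeta> \<alpha> \<longleftrightarrow>
     (\<exists>w. (f \<longlongrightarrow> w) (at \<zeta> within ball 0 1) \<and> \<alpha> = opening_angle f \<zeta> w (at_right 0)) \<or>
     (filterlim f at_infinity (at \<zeta> within ball 0 1) \<and> \<alpha> = - opening_angle f \<zeta> 0 at_top)"

definition schwarz_christoffel_mapping :: "(complex \<Rightarrow> complex) \<Rightarrow> nat \<Rightarrow> bool" where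
  "schwarz_christoffel_mapping f m \<longleftrightarrow>
     f holomorphic_on ball 0 1 \<and> inj_on f (ball 0 1) \<and> polygonal_boundary (f ` ball 0 1) \<and>
     (\<exists>(z :: nat \<Rightarrow> complex) (\<beta> :: nat \<Rightarrow> real).
        inj_on z {1..m} \<and>
        (\<forall>k\<in>{1..m}. cmod (z k) = 1 \<and> \<beta> k \<noteq> 0 \<and>
           (\<exists>\<alpha>. has_interior_angle f (z k) \<alpha> \<and> 2 * pi * \<beta> k = pi - \<alpha>)) \<and>
        (\<Sum>k=1..m. \<beta> k) = 1 \<and>
        (\<forall>\<zeta>\<in>ball 0 1.
           deriv (deriv f) \<zeta> / deriv f \<zeta> = - 2 * (\<Sum>k=1..m. of_real (\<beta> k) / (\<zeta> - z k))))"

text \<open>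
  The identity \<open>f'' / f' = (2 B\<^sub>1 / B\<^sub>2) / (1 - z B\<^sub>1 / B\<^sub>2)\<close> of meromorphic functions on the disk.
  The zeros of \<open>B\<^sub>2\<close> are left out because division by zero yields 0 in HOL; the identity
  there holds by continuation.
\<close>

definition blaschke_representation ::
  "(complex \<Rightarrow> complex) \<Rightarrow> (complex \<Rightarrow> complex) \<Rightarrow> (complex \<Rightarrow> complex) \<Rightarrow> bool" where
  "blaschke_representation f B1 B2 \<longleftrightarrow>
     (\<forall>z\<in>ball 0 1. B2 z \<noteq> 0 \<longrightarrow>
        deriv (deriv f) z / deriv f z = (2 * (B1 z / B2 z)) / (1 - z * (B1 z / B2 z)))"

definition koebe :: "complex \<Rightarrow> complex" where
  "koebe z = z / (1 - z)\<^sup>2"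

end

theory Submission
  imports Defs
begin

text \<open>
  Write \<open>B = B\<^sub>1 / B\<^sub>2\<close>. Comparing residues at a pre-vertex gives
  \<open>\<beta>\<^sub>k (1 + z\<^sub>k B'(z\<^sub>k) / B(z\<^sub>k)) = 1\<close>. On the unit circle \<open>z B' / B\<close> is the sum of the
  Poisson kernels of the zeros of \<open>B\<^sub>1\<close> minus that of the zeros of \<open>B\<^sub>2\<close>, and each kernel lies
  between \<open>(1 - r) / (1 + r)\<close> and \<open>(1 + r) / (1 - r)\<close>. If all \<open>\<beta>\<^sub>k\<close> were positive, then
  \<open>1 + z f'' / f'\<close> would have positive real part, but its value at the zeros of \<open>B\<^sub>2\<close> is \<open>-1\<close>.
  So some \<open>\<beta>\<^sub>k\<close> is negative, and it is at least \<open>-1/2\<close> because interior angles are at most \<open>2\<pi>\<close>;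
  this gives the first bound. Some \<open>\<beta>\<^sub>k\<close> is positive because their sum is 1; this gives the second.
\<close>

section \<open>Boundary derivatives of finite Blaschke products and bounds for the Poisson
  kernel\<close>

text \<open>On the unit circle \<open>1 - cnj a * z = z * cnj (z - a)\<close>. Hence
  \<open>z\<close> times the logarithmic derivative of a Blaschke factor is real there, and it is
  the Poisson kernel of \<open>a\<close> at \<open>z\<close>.\<close>

lemma has_field_derivative_blaschke_factor:
  fixes a z :: complex
  assumes "cmod a < 1" "cmod z = 1"
  shows "((\<lambda>z. (z - a) / (1 - cnj a * z)) has_field_derivative
           (z - a) / (1 - cnj a * z) * of_real ((1 - (cmod a)\<^sup>2) / (cmod (z - a))\<^sup>2) / z) (at z)"
proof -
  have z: "z \<noteq> 0" "z - a \<noteq> 0" using assms by auto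
  have zz: "z * cnj z = 1" using assms by (simp add: complex_norm_square[symmetric])
  have e: "1 - cnj a * z = z * cnj (z - a)" using zz by (simp add: algebra_simps)
  have ne: "1 - cnj a * z \<noteq> 0" unfolding e using z by simp
  have aa: "of_real ((cmod a)\<^sup>2) = a * cnj a" "of_real ((cmod (z - a))\<^sup>2) = (z - a) * cnj (z - a)"
    by (simp_all only: complex_norm_square)
  have "((\<lambda>z. (z - a) / (1 - cnj a * z)) has_field_derivative
      (1 - a * cnj a) / (1 - cnj a * z)\<^sup>2) (at z)"
    by (rule derivative_eq_intros refl | use ne in \<open>simp add: field_simps power2_eq_square\<close>)+
  also have "(1 - a * cnj a) / (1 - cnj a * z)\<^sup>2
      = (z - a) / (1 - cnj a * z) * ((1 - a * cnj a) / ((z - a) * cnj (z - a))) / z"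
  proof -
    \<comment> \<open>Used with \<open>N = 1 - a * cnj a\<close>, \<open>u = z - a\<close> and
      \<open>w = cnj (z - a)\<close>, so that the conjugates are opaque to the simplifier.\<close>
    have "N / (z * w)\<^sup>2 = u / (z * w) * (N / (u * w)) / z" if "u \<noteq> 0" for N u w :: complex
      using that z(1) by (simp add: field_simps power2_eq_square)
    then show ?thesis unfolding e using z(2) by blast
  qed
  finally show ?thesis by (simp only: of_real_divide of_real_diff aa of_real_1)
qed

text \<open>Logarithmic derivatives add under multiplication, so the kernels of the zeros are
  summed. Writing the derivative as value times kernel sum over \<open>z\<close> is the form that
  the residue comparison consumes.\<close>

lemma has_field_derivative_blaschke:
  fixes c z :: complex and d :: nat
  assumes "\<And>k. k \<in> {1..d} \<Longrightarrow> cmod (a k) < 1" "cmod z = 1"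
  shows "((\<lambda>z. c * (\<Prod>k=1..d. (z - a k) / (1 - cnj (a k) * z))) has_field_derivative
           c * (\<Prod>k=1..d. (z - a k) / (1 - cnj (a k) * z)) *
           of_real (\<Sum>k=1..d. (1 - (cmod (a k))\<^sup>2) / (cmod (z - a k))\<^sup>2) / z) (at z)"
  using assms
proof (induction d)
  case 0
  then show ?case by simp
next
  case (Suc d)
  have "((\<lambda>z. c * (\<Prod>k=1..d. (z - a k) / (1 - cnj (a k) * z)) *
        ((z - a (Suc d)) / (1 - cnj (a (Suc d)) * z))) has_field_derivative
     c * (\<Prod>k=1..d. (z - a k) / (1 - cnj (a k) * z)) *
       of_real (\<Sum>k=1..d. (1 - (cmod (a k))\<^sup>2) / (cmod (z - a k))\<^sup>2) / z *
       ((z - a (Suc d)) / (1 - cnj (a (Suc d)) * z)) +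
     (z - a (Suc d)) / (1 - cnj (a (Suc d)) * z) *
       of_real ((1 - (cmod (a (Suc d)))\<^sup>2) / (cmod (z - a (Suc d)))\<^sup>2) / z *
       (c * (\<Prod>k=1..d. (z - a k) / (1 - cnj (a k) * z)))) (at z)"
    by (intro DERIV_mult Suc.IH has_field_derivative_blaschke_factor) (use Suc.prems assms(2) in auto)
  moreover have "\<And>A F X Y. A * X / z * F + F * Y / z * A = A * F * (X + Y) / z"
    by (simp add: add_divide_distrib ring_distribs ac_simps)
  ultimately show ?case
    by (simp only: prod.cl_ivl_Suc sum.cl_ivl_Suc of_real_add) (simp add: mult.assoc)
qed

text \<open>With \<open>t = cmod a\<close>, the distance from \<open>z\<close> to \<open>a\<close>
  lies between \<open>1 - t\<close> and \<open>1 + t\<close>, so the kernel lies between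
  \<open>(1 - t) / (1 + t)\<close> and its reciprocal. Both bounds are monotone in \<open>t\<close>,
  hence \<open>t\<close> can be replaced by \<open>r\<close>.\<close>

lemma poisson_kernel_bounds:
  fixes a z :: complex
  assumes "cmod a \<le> r" "r < 1" "cmod z = 1"
  shows "(1 - r) / (1 + r) \<le> (1 - (cmod a)\<^sup>2) / (cmod (z - a))\<^sup>2"
    and "(1 - (cmod a)\<^sup>2) / (cmod (z - a))\<^sup>2 \<le> (1 + r) / (1 - r)"
proof -
  define t where "t = cmod a"
  have t: "0 \<le> t" "t \<le> r" "t < 1" using assms by (auto simp: t_def)
  have l: "1 - t \<le> cmod (z - a)" using norm_triangle_ineq2[of z a] assms by (simp add: t_def)
  have u: "cmod (z - a) \<le> 1 + t" using norm_triangle_ineq4[of z a] assms by (simp add: t_def)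
  have p: "0 < cmod (z - a)" using l t by linarith
  have f: "1 - t\<^sup>2 = (1 - t) * (1 + t)" by (simp add: power2_eq_square algebra_simps)
  have "(1 - r) / (1 + r) \<le> (1 - t) / (1 + t)" using t by (simp add: divide_simps algebra_simps)
  also have "\<dots> = (1 - t\<^sup>2) / (1 + t)\<^sup>2" unfolding f using t by (simp add: power2_eq_square)
  also have "\<dots> \<le> (1 - t\<^sup>2) / (cmod (z - a))\<^sup>2"
    using t u p unfolding f by (intro divide_left_mono power_mono) auto
  finally show "(1 - r) / (1 + r) \<le> (1 - (cmod a)\<^sup>2) / (cmod (z - a))\<^sup>2" unfolding t_def .
  have "(1 - t\<^sup>2) / (cmod (z - a))\<^sup>2 \<le> (1 - t\<^sup>2) / (1 - t)\<^sup>2"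
    using t l p unfolding f by (intro divide_left_mono power_mono) auto
  also have "\<dots> = (1 + t) / (1 - t)" unfolding f using t by (simp add: power2_eq_square)
  also have "\<dots> \<le> (1 + r) / (1 - r)" using t assms by (simp add: divide_simps algebra_simps)
  finally show "(1 - (cmod a)\<^sup>2) / (cmod (z - a))\<^sup>2 \<le> (1 + r) / (1 - r)" unfolding t_def .
qed

section \<open>Comparison of residues at a pre-vertex\<close>

text \<open>The identities for \<open>f'' / f'\<close> hold only inside the disk, so limits at a
  pre-vertex are taken from inside; this makes such limits unique.\<close>

lemma at_within_unit_ball_neq_bot:
  fixes z :: complex
  assumes "cmod z = 1"
  shows "at z within ball 0 1 \<noteq> bot"
proof -
  have "z islimpt ball 0 1"
    using assms by (subst islimpt_ball) auto
  then show ?thesis by (simp add: trivial_limit_within)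
qed

lemma isCont_sum_other_poles:
  fixes z :: "nat \<Rightarrow> complex" and \<beta> :: "nat \<Rightarrow> real"
  assumes "inj_on z A" "k \<in> A"
  shows "isCont (\<lambda>\<zeta>. \<Sum>j\<in>A-{k}. of_real (\<beta> j) / (\<zeta> - z j)) (z k)"
proof -
  have "z k - z j \<noteq> 0" if "j \<in> A - {k}" for j
    using assms inj_onD[of z A k j] that by auto
  then show ?thesis by (intro continuous_intros) auto
qed

text \<open>The sum in \<open>eq\<close> is \<open>- f'' / (2 * f')\<close>, which has a simple pole
  with residue \<open>- \<beta> k / 2\<close> times \<open>- 2\<close> in \<open>f'' / f'\<close>.
  Multiplying \<open>eq\<close> by \<open>\<zeta> - z k\<close> first forces the zero of
  \<open>Q = B2 - \<zeta> * B1\<close> at \<open>z k\<close>; dividing \<open>Q\<close> by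
  \<open>\<zeta> - z k\<close> then compares \<open>\<beta> k * Q'\<close> with \<open>- B1\<close>
  at \<open>z k\<close>.\<close>

lemma exponent_at_prevertex:
  fixes z :: "nat \<Rightarrow> complex" and \<beta> :: "nat \<Rightarrow> real" and B1 B2 :: "complex \<Rightarrow> complex"
  assumes inj: "inj_on z {1..m}" and k: "k \<in> {1..m}" and zk: "cmod (z k) = 1" and \<beta>: "\<beta> k \<noteq> 0"
    and eq: "\<And>\<zeta>. \<zeta> \<in> ball 0 1 \<Longrightarrow>
              (\<Sum>j=1..m. of_real (\<beta> j) / (\<zeta> - z j)) * (B2 \<zeta> - \<zeta> * B1 \<zeta>) = - B1 \<zeta>"
    and D1: "(B1 has_field_derivative B1 (z k) * of_real S1 / z k) (at (z k))"
    and D2: "(B2 has_field_derivative B2 (z k) * of_real S2 / z k) (at (z k))"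
    and nz: "B1 (z k) \<noteq> 0"
  shows "\<beta> k * (1 + S1 - S2) = 1"
proof -
  define Q where "Q = (\<lambda>\<zeta>. B2 \<zeta> - \<zeta> * B1 \<zeta>)"
  define g where "g = (\<lambda>\<zeta>. \<Sum>j\<in>{1..m}-{k}. of_real (\<beta> j) / (\<zeta> - z j))"
  define F where "F = at (z k) within ball 0 1"
  have F: "F \<noteq> bot" unfolding F_def by (rule at_within_unit_ball_neq_bot[OF zk])
  have zk0: "z k \<noteq> 0" using zk by auto
  have le: "F \<le> at (z k)" unfolding F_def by (rule at_le) simp
  have cB1: "(B1 \<longlongrightarrow> B1 (z k)) F"
    using DERIV_isCont[OF D1] le unfolding isCont_def by (rule tendsto_mono[rotated])
  have cB2: "(B2 \<longlongrightarrow> B2 (z k)) F"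
    using DERIV_isCont[OF D2] le unfolding isCont_def by (rule tendsto_mono[rotated])
  have id: "((\<lambda>\<zeta>. \<zeta>) \<longlongrightarrow> z k) F" unfolding F_def by simp
  have cg: "(g \<longlongrightarrow> g (z k)) F"
    using isCont_sum_other_poles[OF inj k, of \<beta>] le unfolding g_def isCont_def by (rule tendsto_mono[rotated])
  have evF: "\<forall>\<^sub>F \<zeta> in F. \<zeta> \<in> ball 0 1 \<and> \<zeta> \<noteq> z k"
    unfolding F_def by (auto simp: eventually_at_filter)
  \<comment> \<open>The pole at \<open>z k\<close> is split off from the sum; the remainder
    \<open>g\<close> is continuous there.\<close>
  have key: "(of_real (\<beta> k) + (\<zeta> - z k) * g \<zeta>) * (Q \<zeta> / (\<zeta> - z k)) = - B1 \<zeta>"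
    if "\<zeta> \<in> ball 0 1" "\<zeta> \<noteq> z k" for \<zeta>
  proof -
    have "(\<Sum>j=1..m. of_real (\<beta> j) / (\<zeta> - z j)) = of_real (\<beta> k) / (\<zeta> - z k) + g \<zeta>"
      unfolding g_def using k by (simp add: sum.remove)
    then have "(of_real (\<beta> k) / (\<zeta> - z k) + g \<zeta>) * Q \<zeta> = - B1 \<zeta>"
      using eq[OF that(1)] by (simp add: Q_def)
    then show ?thesis using that(2) by (simp add: field_simps)
  qed
  have L: "((\<lambda>\<zeta>. of_real (\<beta> k) + (\<zeta> - z k) * g \<zeta>) \<longlongrightarrow> of_real (\<beta> k) + (z k - z k) * g (z k)) F"
    by (intro tendsto_intros id cg)
  \<comment> \<open>The same function has two limits: \<open>\<beta> k * Q (z k)\<close> by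
    continuity and 0 by \<open>key\<close>. Since \<open>\<beta> k\<close> is nonzero,
    \<open>Q (z k) = 0\<close>.\<close>
  have "((\<lambda>\<zeta>. (of_real (\<beta> k) + (\<zeta> - z k) * g \<zeta>) * Q \<zeta>) \<longlongrightarrow>
      (of_real (\<beta> k) + (z k - z k) * g (z k)) * Q (z k)) F"
    unfolding Q_def by (intro tendsto_intros L id cB1 cB2)
  moreover have "((\<lambda>\<zeta>. (of_real (\<beta> k) + (\<zeta> - z k) * g \<zeta>) * Q \<zeta>) \<longlongrightarrow>
      - B1 (z k) * (z k - z k)) F"
  proof (rule Lim_transform_eventually)
    show "((\<lambda>\<zeta>. - B1 \<zeta> * (\<zeta> - z k)) \<longlongrightarrow> - B1 (z k) * (z k - z k)) F"
      by (intro tendsto_intros cB1 id)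
    show "\<forall>\<^sub>F \<zeta> in F. - B1 \<zeta> * (\<zeta> - z k) = (of_real (\<beta> k) + (\<zeta> - z k) * g \<zeta>) * Q \<zeta>"
      using evF by eventually_elim (use key in \<open>force simp: field_simps\<close>)
  qed
  ultimately have "(of_real (\<beta> k) + (z k - z k) * g (z k)) * Q (z k) = - B1 (z k) * (z k - z k)"
    by (rule tendsto_unique[OF F])
  then have Q0: "Q (z k) = 0" using \<beta> by simp
  have "(Q has_field_derivative B2 (z k) * of_real S2 / z k
      - (1 * B1 (z k) + B1 (z k) * of_real S1 / z k * z k)) (at (z k))"
    unfolding Q_def by (intro DERIV_diff DERIV_mult D1 D2 DERIV_ident)
  \<comment> \<open>The zero of \<open>Q\<close> says \<open>B2 (z k) = z k * B1 (z k)\<close>,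
    which lets \<open>B1 (z k)\<close> be factored out of the derivative and cancelled at the
    end.\<close>
  moreover have "B2 (z k) * of_real S2 / z k - (1 * B1 (z k) + B1 (z k) * of_real S1 / z k * z k)
      = B1 (z k) * (of_real S2 - 1 - of_real S1)"
    using Q0 zk0 by (simp add: Q_def field_simps)
  ultimately have "((\<lambda>\<zeta>. (Q \<zeta> - Q (z k)) / (\<zeta> - z k)) \<longlongrightarrow>
      B1 (z k) * (of_real S2 - 1 - of_real S1)) (at (z k))"
    by (simp add: has_field_derivative_iff)
  then have QD: "((\<lambda>\<zeta>. Q \<zeta> / (\<zeta> - z k)) \<longlongrightarrow> B1 (z k) * (of_real S2 - 1 - of_real S1)) F"
    using tendsto_mono[OF le] Q0 by simp
  have "((\<lambda>\<zeta>. (of_real (\<beta> k) + (\<zeta> - z k) * g \<zeta>) * (Q \<zeta> / (\<zeta> - z k))) \<longlongrightarrow>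
      (of_real (\<beta> k) + (z k - z k) * g (z k)) * (B1 (z k) * (of_real S2 - 1 - of_real S1))) F"
    by (intro tendsto_mult[OF L QD])
  moreover have "((\<lambda>\<zeta>. (of_real (\<beta> k) + (\<zeta> - z k) * g \<zeta>) * (Q \<zeta> / (\<zeta> - z k))) \<longlongrightarrow> - B1 (z k)) F"
  proof (rule Lim_transform_eventually)
    show "((\<lambda>\<zeta>. - B1 \<zeta>) \<longlongrightarrow> - B1 (z k)) F" by (intro tendsto_intros cB1)
    show "\<forall>\<^sub>F \<zeta> in F. - B1 \<zeta> = (of_real (\<beta> k) + (\<zeta> - z k) * g \<zeta>) * (Q \<zeta> / (\<zeta> - z k))"
      using evF by eventually_elim (use key in force)
  qed
  ultimately have "of_real (\<beta> k) * (B1 (z k) * (of_real S2 - 1 - of_real S1)) = - B1 (z k)"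
    using tendsto_unique[OF F] by fastforce
  then have "(of_real (\<beta> k) * (of_real S2 - 1 - of_real S1)) * B1 (z k) = (-1) * B1 (z k)"
    by (simp add: ac_simps)
  then have "of_real (\<beta> k) * (of_real S2 - 1 - of_real S1) = (-1 :: complex)"
    using nz mult_cancel_right by blast
  then have "of_real (\<beta> k * (S2 - 1 - S1)) = (of_real (-1) :: complex)" by simp
  then have "\<beta> k * (S2 - 1 - S1) = -1" by (simp only: of_real_eq_iff)
  then show ?thesis by (simp add: algebra_simps)
qed

section \<open>Bounds for interior angles and a half-plane estimate\<close>

text \<open>All directions lie in an interval of length \<open>2 * pi\<close>. If the set of
  directions were not measurable, \<open>measure\<close> would return its default value 0, so the
  bound holds in that case as well.\<close>

lemma opening_angle_le: "opening_angle f \<zeta> w F \<le> 2 * pi"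
proof (cases "{\<theta>\<in>{0..<2 * pi}.
          (\<forall>\<^sub>F \<rho> in F. w + of_real \<rho> * cis \<theta> \<in> f ` ball 0 1) \<and>
          ((\<lambda>\<rho>. inv_into (ball 0 1) f (w + of_real \<rho> * cis \<theta>)) \<longlongrightarrow> \<zeta>) F} \<in> sets lebesgue")
  case True
  then have "opening_angle f \<zeta> w F \<le> measure lebesgue {0..<2 * pi}"
    unfolding opening_angle_def
    by (intro measure_mono_fmeasurable) (auto intro: fmeasurableI)
  then show ?thesis by simp
next
  case False
  then show ?thesis unfolding opening_angle_def by (simp add: measure_notin_sets)
qed

text \<open>At infinity the angle is minus an opening, hence nonpositive. Through
  \<open>2 * pi * \<beta> = pi - \<alpha>\<close> the estimate becomes
  \<open>\<beta> \<ge> - 1 / 2\<close>, which is how the angles enter the radius bounds.\<close>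

lemma interior_angle_le: "has_interior_angle f \<zeta> \<alpha> \<Longrightarrow> \<alpha> \<le> 2 * pi"
  unfolding has_interior_angle_def
proof (elim disjE exE conjE)
  assume "\<alpha> = - opening_angle f \<zeta> 0 at_top"
  moreover have "opening_angle f \<zeta> 0 at_top \<ge> 0" by (simp add: opening_angle_def)
  ultimately show ?thesis using pi_gt_zero by linarith
qed (simp add: opening_angle_le)

text \<open>The quantity \<open>1 - 2 * (a / (a - z))\<close> equals
  \<open>(z + a) / (z - a)\<close>, whose real part has the sign of
  \<open>(cmod z)\<^sup>2 - (cmod a)\<^sup>2\<close>.\<close>

lemma Re_divide_diff_unit_circle:
  fixes a z :: complex
  assumes "cmod a < 1" "cmod z = 1"
  shows "Re (a / (a - z)) < 1 / 2"
proof -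
  have ne: "a - z \<noteq> 0" using assms by auto
  have "1 - 2 * (a / (a - z)) = (z + a) / (z - a)" using ne by (simp add: field_simps)
  moreover have "Re ((z + a) / (z - a)) > 0"
  proof -
    have "(Re a)\<^sup>2 + (Im a)\<^sup>2 < (Re z)\<^sup>2 + (Im z)\<^sup>2"
      using assms power_strict_mono[of "cmod a" 1 2] by (simp add: cmod_power2[symmetric])
    moreover have "(Re (z - a))\<^sup>2 + (Im (z - a))\<^sup>2 > 0"
      using ne by (metis complex_neq_0 minus_diff_eq neg_equal_0_iff_equal)
    ultimately show ?thesis
      by (simp add: Re_divide power2_eq_square algebra_simps)
  qed
  ultimately have "Re (1 - 2 * (a / (a - z))) > 0" by (simp only:)
  moreover have "Re (1 - 2 * (a / (a - z))) = 1 - 2 * Re (a / (a - z))"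
    unfolding minus_complex.simps one_complex.simps mult_2 plus_complex.simps ..
  ultimately show ?thesis by linarith
qed

section \<open>The two lower bounds for the radius\<close>

text \<open>In terms of \<open>K = (1 + r) / (1 - r)\<close> both hypotheses are quadratic
  inequalities. With \<open>x = d2 * K\<close> the first gives
  \<open>x\<^sup>2 - 3 * x \<ge> d1 * d2\<close>; with \<open>y = d2 / K\<close> the second gives
  \<open>y\<^sup>2 - y \<le> d1 * d2\<close>. Completing the squares and solving for
  \<open>r\<close> yields the bounds.\<close>

lemma radius_bounds:
  fixes d1 d2 r :: real
  assumes d: "0 \<le> d1" "0 < d2" and r: "0 \<le> r" "r < 1"
    and lo: "d1 * ((1 - r) / (1 + r)) - d2 * ((1 + r) / (1 - r)) \<le> -3"
    and hi: "d1 * ((1 + r) / (1 - r)) - d2 * ((1 - r) / (1 + r)) \<ge> -1"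
  shows "(sqrt (4 * d1 * d2 + 9) + 3 - 2 * d2) / (sqrt (4 * d1 * d2 + 9) + 3 + 2 * d2) \<le> r"
    and "(2 * d2 - 1 - sqrt (1 + 4 * d1 * d2)) / (2 * d2 + 1 + sqrt (1 + 4 * d1 * d2)) \<le> r"
proof -
  define K where "K = (1 + r) / (1 - r)"
  have K: "K > 0" using r by (simp add: K_def)
  have Ki: "(1 - r) / (1 + r) = 1 / K" by (simp add: K_def)
  have l: "d1 / K + 3 \<le> d2 * K" using lo by (simp add: Ki K_def[symmetric])
  have h: "d2 / K \<le> d1 * K + 1" using hi by (simp add: Ki K_def[symmetric])
  have "0 \<le> d1 / K" using d K by simp
  \<comment> \<open>This sign selects the branch of the square root.\<close>
  with l have X: "2 * (d2 * K) - 3 \<ge> 0" by linarith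
  have "(d1 / K + 3) * (d2 * K) \<le> (d2 * K) * (d2 * K)" using l d K by (intro mult_right_mono) auto
  then have "4 * d1 * d2 + 9 \<le> (2 * (d2 * K) - 3)\<^sup>2"
    using K by (simp add: power2_eq_square algebra_simps)
  then have s: "sqrt (4 * d1 * d2 + 9) \<le> 2 * (d2 * K) - 3" using X by (intro real_le_lsqrt)
  define S where "S = sqrt (4 * d1 * d2 + 9)"
  have S0: "S \<ge> 0" using d by (simp add: S_def)
  have "S + 3 \<le> 2 * d2 * ((1 + r) / (1 - r))" using s unfolding S_def K_def mult.assoc by (simp only: le_diff_eq)
  then have "(S + 3) * (1 - r) \<le> 2 * d2 * (1 + r)" using r by (simp add: pos_le_divide_eq)
  then have "S + 3 - 2 * d2 \<le> r * (S + 3 + 2 * d2)" by (simp add: algebra_simps)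
  then show "(sqrt (4 * d1 * d2 + 9) + 3 - 2 * d2) / (sqrt (4 * d1 * d2 + 9) + 3 + 2 * d2) \<le> r"
    using S0 d unfolding S_def[symmetric] by (simp add: pos_divide_le_eq)
  have "(d2 / K) * (d2 / K) \<le> (d1 * K + 1) * (d2 / K)" using h d K by (intro mult_right_mono) auto
  moreover have "(d1 * K + 1) * (d2 / K) = d1 * d2 + d2 / K" using K by (simp add: field_simps)
  moreover have "(2 * (d2 / K) - 1)\<^sup>2 = 4 * ((d2 / K) * (d2 / K)) - 4 * (d2 / K) + 1"
    by (simp only: power2_eq_square) algebra
  ultimately have "(2 * (d2 / K) - 1)\<^sup>2 \<le> 1 + 4 * d1 * d2" by linarith
  then have t: "2 * (d2 / K) - 1 \<le> sqrt (1 + 4 * d1 * d2)" by (rule real_le_rsqrt)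
  define T where "T = sqrt (1 + 4 * d1 * d2)"
  have T0: "T \<ge> 0" using d by (simp add: T_def)
  have "2 * d2 * ((1 - r) / (1 + r)) \<le> T + 1" using t by (simp add: T_def Ki)
  then have "2 * d2 * (1 - r) \<le> (T + 1) * (1 + r)" using r by (simp add: pos_divide_le_eq)
  then have "2 * d2 - 1 - T \<le> r * (2 * d2 + 1 + T)" by (simp add: algebra_simps)
  then show "(2 * d2 - 1 - sqrt (1 + 4 * d1 * d2)) / (2 * d2 + 1 + sqrt (1 + 4 * d1 * d2)) \<le> r"
    using T0 d unfolding T_def[symmetric] by (simp add: pos_divide_le_eq)
qed

lemma schwarz_christoffel_radius_bounds:
  assumes sc: "schwarz_christoffel_mapping f m"
    and B1: "finite_blaschke_product B1 d1" and B2: "finite_blaschke_product B2 d2"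
    and disj: "blaschke_zeros B1 \<inter> blaschke_zeros B2 = {}"
    and d2: "d2 \<ge> 1" and rep: "blaschke_representation f B1 B2" and r: "r < 1"
    and zeros: "blaschke_zeros B1 \<union> blaschke_zeros B2 \<subseteq> cball 0 r"
  shows "(sqrt (4 * real d1 * real d2 + 9) + 3 - 2 * real d2) /
           (sqrt (4 * real d1 * real d2 + 9) + 3 + 2 * real d2) \<le> r"
    and "(2 * real d2 - 1 - sqrt (1 + 4 * real d1 * real d2)) /
           (2 * real d2 + 1 + sqrt (1 + 4 * real d1 * real d2)) \<le> r"
proof -
  obtain z :: "nat \<Rightarrow> complex" and \<beta> :: "nat \<Rightarrow> real" where
    inj: "inj_on z {1..m}" and
    ball: "\<forall>k\<in>{1..m}. cmod (z k) = 1 \<and> \<beta> k \<noteq> 0 \<and>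
             (\<exists>\<alpha>. has_interior_angle f (z k) \<alpha> \<and> 2 * pi * \<beta> k = pi - \<alpha>)" and
    sum1: "(\<Sum>k=1..m. \<beta> k) = 1" and
    P: "\<forall>\<zeta>\<in>ball 0 1.
          deriv (deriv f) \<zeta> / deriv f \<zeta> = - 2 * (\<Sum>k=1..m. of_real (\<beta> k) / (\<zeta> - z k))"
    using sc unfolding schwarz_christoffel_mapping_def by (elim conjE exE) (rule that)
  note P = P[rule_format]
  have zk: "\<And>k. k \<in> {1..m} \<Longrightarrow> cmod (z k) = 1" and \<beta>: "\<And>k. k \<in> {1..m} \<Longrightarrow> \<beta> k \<noteq> 0" and
    ang: "\<And>k. k \<in> {1..m} \<Longrightarrow> \<exists>\<alpha>. has_interior_angle f (z k) \<alpha> \<and> 2 * pi * \<beta> k = pi - \<alpha>"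
    using ball by blast+
  obtain c1 a1 where c1: "cmod c1 = 1" and a1: "\<And>k. k \<in> {1..d1} \<Longrightarrow> cmod (a1 k) < 1" and
    B1eq: "\<And>z. z \<in> ball 0 1 \<Longrightarrow> B1 z = c1 * (\<Prod>k=1..d1. (z - a1 k) / (1 - cnj (a1 k) * z))"
    using B1 unfolding finite_blaschke_product_def by blast
  obtain c2 a2 where c2: "cmod c2 = 1" and a2: "\<And>k. k \<in> {1..d2} \<Longrightarrow> cmod (a2 k) < 1" and
    B2eq: "\<And>z. z \<in> ball 0 1 \<Longrightarrow> B2 z = c2 * (\<Prod>k=1..d2. (z - a2 k) / (1 - cnj (a2 k) * z))"
    using B2 unfolding finite_blaschke_product_def by blast
  \<comment> \<open>\<open>B1\<close> and \<open>B2\<close> are prescribed only on the open disk;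
    the explicit formulas \<open>A1\<close> and \<open>A2\<close> continue them to the circle, where
    derivatives at the pre-vertices are taken. The function \<open>G\<close> below is
    \<open>- f'' / (2 * f')\<close> on the disk.\<close>
  define A1 where "A1 = (\<lambda>z. c1 * (\<Prod>k=1..d1. (z - a1 k) / (1 - cnj (a1 k) * z)))"
  define A2 where "A2 = (\<lambda>z. c2 * (\<Prod>k=1..d2. (z - a2 k) / (1 - cnj (a2 k) * z)))"
  define G where "G = (\<lambda>\<zeta>. \<Sum>j=1..m. of_real (\<beta> j) / (\<zeta> - z j))"
  have BA: "B1 \<zeta> = A1 \<zeta>" "B2 \<zeta> = A2 \<zeta>" if "\<zeta> \<in> ball 0 1" for \<zeta>
    using that B1eq B2eq by (simp_all add: A1_def A2_def)
  have r1: "cmod (a1 k) \<le> r" if "k \<in> {1..d1}" for k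
  proof -
    have "A1 (a1 k) = 0" using that by (auto simp: A1_def)
    then have "a1 k \<in> blaschke_zeros B1" using BA[of "a1 k"] a1[OF that] by (simp add: blaschke_zeros_def)
    then show ?thesis using zeros by auto
  qed
  have r2: "cmod (a2 k) \<le> r" "A2 (a2 k) = 0" if "k \<in> {1..d2}" for k
  proof -
    show A: "A2 (a2 k) = 0" using that by (auto simp: A2_def)
    then have "a2 k \<in> blaschke_zeros B2" using BA[of "a2 k"] a2[OF that] by (simp add: blaschke_zeros_def)
    then show "cmod (a2 k) \<le> r" using zeros by auto
  qed
  have one: "1 \<in> {1..d2}" using d2 by simp
  \<comment> \<open>Since \<open>d2 \<ge> 1\<close>, there is a zero of \<open>B2\<close>, and its
    modulus is at most \<open>r\<close>.\<close>
  have r0: "0 \<le> r" using r2(1)[OF one] norm_ge_zero order_trans by blast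
  have den: "1 - cnj a * \<zeta> \<noteq> 0" if "cmod a < 1" "cmod \<zeta> \<le> 1" for a \<zeta> :: complex
  proof
    assume "1 - cnj a * \<zeta> = 0"
    then have "cmod (cnj a * \<zeta>) = 1" by (metis eq_iff_diff_eq_0 norm_one)
    then have "cmod a * cmod \<zeta> = 1" by (simp add: norm_mult)
    then show False using that mult_left_le[of "cmod \<zeta>" "cmod a"] by simp
  qed
  have contA: "isCont A1 \<zeta>" "isCont A2 \<zeta>" "isCont G \<zeta>" if "\<zeta> \<in> ball 0 1" for \<zeta>
  proof -
    have n: "cmod \<zeta> \<le> 1" "\<And>j. j \<in> {1..m} \<Longrightarrow> \<zeta> \<noteq> z j" using that zk by fastforce+
    show "isCont A1 \<zeta>" "isCont A2 \<zeta>" "isCont G \<zeta>"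
      unfolding A1_def A2_def G_def
      by (intro continuous_intros den a1 a2 n; use n in simp)+
  qed
  have A2ne: "A2 \<zeta> \<noteq> 0" if "\<zeta> \<in> ball 0 1" "\<forall>k\<in>{1..d2}. \<zeta> \<noteq> a2 k" for \<zeta>
    using that c2 den a2 by (auto simp: A2_def)
  have eq0: "G \<zeta> * (A2 \<zeta> - \<zeta> * A1 \<zeta>) = - A1 \<zeta>" if "\<zeta> \<in> ball 0 1" "A2 \<zeta> \<noteq> 0" "A2 \<zeta> - \<zeta> * A1 \<zeta> \<noteq> 0" for \<zeta>
  proof -
    have "- 2 * G \<zeta> = (2 * (A1 \<zeta> / A2 \<zeta>)) / (1 - \<zeta> * (A1 \<zeta> / A2 \<zeta>))"
      using rep[unfolded blaschke_representation_def, rule_format, OF that(1)] P[OF that(1)] that(2) BA[OF that(1)]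
      by (simp add: G_def)
    also have "\<dots> = 2 * A1 \<zeta> / (A2 \<zeta> - \<zeta> * A1 \<zeta>)"
      using that by (simp add: divide_simps)
    finally have e: "- 2 * G \<zeta> = 2 * A1 \<zeta> / (A2 \<zeta> - \<zeta> * A1 \<zeta>)" .
    have "- 2 * G \<zeta> * (A2 \<zeta> - \<zeta> * A1 \<zeta>) = 2 * A1 \<zeta>"
      by (rule iffD1[OF nonzero_eq_divide_eq[OF that(3)] e])
    then show ?thesis by algebra
  qed
  \<comment> \<open>Where the denominator \<open>1 - z B1 / B2\<close> vanishes, the representation degenerates to \<open>f'' / f' = 0\<close>.\<close>
  have G0: "G \<zeta> = 0" if "\<zeta> \<in> ball 0 1" "A2 \<zeta> \<noteq> 0" "A2 \<zeta> - \<zeta> * A1 \<zeta> = 0" for \<zeta>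
  proof -
    have "1 - \<zeta> * (A1 \<zeta> / A2 \<zeta>) = 0" using that by (simp add: field_simps)
    then show ?thesis
      using rep[unfolded blaschke_representation_def, rule_format, OF that(1)] P[OF that(1)] that(2) BA[OF that(1)]
      by (simp add: G_def)
  qed
  obtain k0 where k0: "k0 \<in> {1..m}" using sum1 by (metis sum.neutral zero_neq_one)
  \<comment> \<open>If \<open>G\<close> vanished on the disk, letting \<open>\<zeta>\<close> tend to
    \<open>z k0\<close> in \<open>(\<zeta> - z k0) * G \<zeta>\<close> would give
    \<open>\<beta> k0 = 0\<close>. Excluding this prevents the degenerate case of a vanishing
    denominator from filling an open set.\<close>
  have "\<exists>\<xi>\<in>ball 0 1. G \<xi> \<noteq> 0"
  proof (rule ccontr)
    assume *: "\<not> (\<exists>\<xi>\<in>ball 0 1. G \<xi> \<noteq> 0)"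
    define g where "g = (\<lambda>\<zeta>. \<Sum>j\<in>{1..m}-{k0}. of_real (\<beta> j) / (\<zeta> - z j))"
    define F where "F = at (z k0) within ball 0 1"
    have F: "F \<noteq> bot" unfolding F_def by (rule at_within_unit_ball_neq_bot[OF zk[OF k0]])
    have le: "F \<le> at (z k0)" unfolding F_def by (rule at_le) simp
    have id: "((\<lambda>\<zeta>. \<zeta>) \<longlongrightarrow> z k0) F" unfolding F_def by simp
    have "(g \<longlongrightarrow> g (z k0)) F"
      using isCont_sum_other_poles[OF inj k0, of \<beta>] le unfolding g_def isCont_def
      by (rule tendsto_mono[rotated])
    then have "((\<lambda>\<zeta>. of_real (\<beta> k0) + (\<zeta> - z k0) * g \<zeta>) \<longlongrightarrow>
        of_real (\<beta> k0) + (z k0 - z k0) * g (z k0)) F"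
      by (intro tendsto_intros id)
    moreover have "((\<lambda>\<zeta>. of_real (\<beta> k0) + (\<zeta> - z k0) * g \<zeta>) \<longlongrightarrow> 0) F"
    proof (rule tendsto_eventually)
      have "\<forall>\<^sub>F \<zeta> in F. \<zeta> \<in> ball 0 1 \<and> \<zeta> \<noteq> z k0"
        unfolding F_def by (auto simp: eventually_at_filter)
      then show "\<forall>\<^sub>F \<zeta> in F. of_real (\<beta> k0) + (\<zeta> - z k0) * g \<zeta> = 0"
      proof eventually_elim
        case (elim \<zeta>)
        have "G \<zeta> = of_real (\<beta> k0) / (\<zeta> - z k0) + g \<zeta>"
          unfolding G_def g_def using k0 by (simp add: sum.remove)
        then show ?case using * elim by (simp add: field_simps)
      qed
    qed
    ultimately have "of_real (\<beta> k0) + (z k0 - z k0) * g (z k0) = 0" by (rule tendsto_unique[OF F])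
    then show False using \<beta>[OF k0] by simp
  qed
  then obtain \<xi> where \<xi>: "\<xi> \<in> ball 0 1" "G \<xi> \<noteq> 0" by blast
  have "G holomorphic_on ball 0 1"
    unfolding G_def using zk by (force intro!: holomorphic_intros)
  then have Gne: "\<forall>\<^sub>F w in at \<zeta>. G w \<noteq> 0" if "\<zeta> \<in> ball 0 1" for \<zeta>
    using non_zero_neighbour_alt[of G "ball 0 1" \<zeta> \<xi>] that \<xi>
    by (auto elim: eventually_mono)
  \<comment> \<open>Near \<open>\<zeta>\<close>, apart from \<open>\<zeta>\<close> itself,
    \<open>G\<close> and \<open>A2\<close> have no zeros. By \<open>G0\<close> the denominator is
    then nonzero too, so \<open>eq0\<close> applies; continuity carries the identity to
    \<open>\<zeta>\<close>, including the zeros of \<open>A2\<close>.\<close>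
  have eq: "G \<zeta> * (A2 \<zeta> - \<zeta> * A1 \<zeta>) = - A1 \<zeta>" if \<zeta>: "\<zeta> \<in> ball 0 1" for \<zeta>
  proof -
    have b: "\<forall>\<^sub>F w in at \<zeta>. w \<in> ball 0 1"
      using \<zeta> by (intro eventually_at_in_open') auto
    have "\<forall>\<^sub>F w in at \<zeta>. \<forall>k\<in>{1..d2}. w \<noteq> a2 k"
      by (intro eventually_ball_finite ballI eventually_neq_at_within) auto
    then have "\<forall>\<^sub>F w in at \<zeta>. G w * (A2 w - w * A1 w) + A1 w = 0"
      using b Gne[OF \<zeta>]
    proof eventually_elim
      case (elim w)
      then show ?case
        using eq0[of w] A2ne[of w] G0[of w] by (cases "A2 w - w * A1 w = 0") auto
    qed
    then have "((\<lambda>w. G w * (A2 w - w * A1 w) + A1 w) \<longlongrightarrow> 0) (at \<zeta>)"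
      by (rule tendsto_eventually)
    moreover have "isCont (\<lambda>w. G w * (A2 w - w * A1 w) + A1 w) \<zeta>"
      using contA[OF \<zeta>] by (intro continuous_intros)
    ultimately have "G \<zeta> * (A2 \<zeta> - \<zeta> * A1 \<zeta>) + A1 \<zeta> = 0"
      unfolding isCont_def by (metis LIM_unique)
    then show ?thesis by (simp add: add_eq_0_iff2)
  qed
  have nonpos: "\<exists>k\<in>{1..m}. \<beta> k < 0"
  proof (rule ccontr)
    assume "\<not> (\<exists>k\<in>{1..m}. \<beta> k < 0)"
    then have pos: "\<beta> k > 0" if "k \<in> {1..m}" for k using \<beta>[OF that] that by force
    \<comment> \<open>At a zero \<open>a\<close> of \<open>B2\<close>, where \<open>B1\<close> is
      nonzero, \<open>eq\<close> reduces to \<open>a * G a = 1\<close>. Positive weights of sum 1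
      would make the real part of \<open>a * G a\<close> smaller than \<open>1 / 2\<close>.\<close>
    define a where "a = a2 1"
    have a: "a \<in> ball 0 1" "A2 a = 0" using a2[OF one] r2(2)[OF one] by (simp_all add: a_def)
    then have "A1 a \<noteq> 0" using disj BA[OF a(1)] by (auto simp: blaschke_zeros_def)
    then have "a * G a = 1" using eq[OF a(1)] a(2) by (simp add: ac_simps)
    then have "Re (\<Sum>k=1..m. of_real (\<beta> k) * (a / (a - z k))) = 1"
      by (simp add: G_def sum_distrib_left mult.commute)
    moreover have "Re (of_real b * w) = b * Re w" for b w by simp
    ultimately have "1 = (\<Sum>k=1..m. \<beta> k * Re (a / (a - z k)))" by (simp only: Re_sum)
    also have "\<dots> < (\<Sum>k=1..m. \<beta> k * (1 / 2))"
      using k0 pos zk a(1) by (intro sum_strict_mono mult_strict_left_mono Re_divide_diff_unit_circle) auto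
    also have "\<dots> = 1 / 2" using sum1 by (simp add: sum_divide_distrib[symmetric])
    finally show False by simp
  qed
  have pos: "\<exists>k\<in>{1..m}. \<beta> k > 0"
    using sum1 sum_nonpos[of "{1..m}" \<beta>] by force
  \<comment> \<open>\<open>S1 k\<close> and \<open>S2 k\<close> are the values of
    \<open>z * B' / B\<close> at \<open>z k\<close> for the two Blaschke products.\<close>
  define S1 where "S1 = (\<lambda>k. \<Sum>j=1..d1. (1 - (cmod (a1 j))\<^sup>2) / (cmod (z k - a1 j))\<^sup>2)"
  define S2 where "S2 = (\<lambda>k. \<Sum>j=1..d2. (1 - (cmod (a2 j))\<^sup>2) / (cmod (z k - a2 j))\<^sup>2)"
  have exponent: "\<beta> k * (1 + S1 k - S2 k) = 1" if k: "k \<in> {1..m}" for k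
  proof (rule exponent_at_prevertex[of z m k \<beta>, OF inj k zk[OF k] \<beta>[OF k]])
    show "(A1 has_field_derivative A1 (z k) * of_real (S1 k) / z k) (at (z k))"
      unfolding A1_def S1_def by (rule has_field_derivative_blaschke[OF a1 zk[OF k]])
    show "(A2 has_field_derivative A2 (z k) * of_real (S2 k) / z k) (at (z k))"
      unfolding A2_def S2_def by (rule has_field_derivative_blaschke[OF a2 zk[OF k]])
    show "A1 (z k) \<noteq> 0" using c1 a1 den[of _ "z k"] zk[OF k] by (force simp: A1_def)
  qed (use eq in \<open>simp add: G_def\<close>)
  have bounds: "real d1 * ((1 - r) / (1 + r)) \<le> S1 k" "S1 k \<le> real d1 * ((1 + r) / (1 - r))"
    "real d2 * ((1 - r) / (1 + r)) \<le> S2 k" "S2 k \<le> real d2 * ((1 + r) / (1 - r))"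
    if "k \<in> {1..m}" for k
    using sum_bounded_below[of "{1..d1}" "(1 - r) / (1 + r)"
        "\<lambda>j. (1 - (cmod (a1 j))\<^sup>2) / (cmod (z k - a1 j))\<^sup>2"]
      sum_bounded_above[of "{1..d1}" "\<lambda>j. (1 - (cmod (a1 j))\<^sup>2) / (cmod (z k - a1 j))\<^sup>2"
        "(1 + r) / (1 - r)"]
      sum_bounded_below[of "{1..d2}" "(1 - r) / (1 + r)"
        "\<lambda>j. (1 - (cmod (a2 j))\<^sup>2) / (cmod (z k - a2 j))\<^sup>2"]
      sum_bounded_above[of "{1..d2}" "\<lambda>j. (1 - (cmod (a2 j))\<^sup>2) / (cmod (z k - a2 j))\<^sup>2"
        "(1 + r) / (1 - r)"]
      poisson_kernel_bounds[OF r1 r zk[OF that]] poisson_kernel_bounds[OF r2(1) r zk[OF that]]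
    by (simp_all add: S1_def S2_def)
  obtain p where p: "p \<in> {1..m}" "\<beta> p > 0" using pos by blast
  \<comment> \<open>A positive exponent gives \<open>S1 p - S2 p > -1\<close>; the upper bound for
    \<open>S1\<close> and the lower bound for \<open>S2\<close> turn this into
    \<open>hi\<close>.\<close>
  have "1 + S1 p - S2 p > 0"
    using exponent[OF p(1)] p(2) by (metis zero_less_mult_pos zero_less_one)
  then have hi: "real d1 * ((1 + r) / (1 - r)) - real d2 * ((1 - r) / (1 + r)) \<ge> -1"
    using bounds[OF p(1)] by linarith
  obtain q where q: "q \<in> {1..m}" "\<beta> q < 0" using nonpos by blast
  \<comment> \<open>A negative exponent is at least \<open>- 1 / 2\<close>, so its reciprocal is at
    most \<open>- 2\<close>. Hence \<open>S1 q - S2 q \<le> - 3\<close>, the constant in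
    \<open>lo\<close>.\<close>
  have "2 * pi * \<beta> q \<ge> - pi" using ang[OF q(1)] interior_angle_le by fastforce
  then have "pi * (2 * \<beta> q) \<ge> pi * (- 1)" by simp
  then have "\<beta> q \<ge> - 1 / 2" by (subst (asm) mult_le_cancel_left_pos) auto
  moreover have "1 + S1 q - S2 q = 1 / \<beta> q" using exponent[OF q(1)] q(2) by (simp add: field_simps)
  moreover have "1 / \<beta> q \<le> - 2" using \<open>\<beta> q \<ge> - 1 / 2\<close> q(2) by (simp add: neg_divide_le_eq)
  ultimately have "1 + S1 q - S2 q \<le> - 2" by simp
  then have lo: "real d1 * ((1 - r) / (1 + r)) - real d2 * ((1 + r) / (1 - r)) \<le> -3"
    using bounds[OF q(1)] by linarith
  show "(sqrt (4 * real d1 * real d2 + 9) + 3 - 2 * real d2) /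
           (sqrt (4 * real d1 * real d2 + 9) + 3 + 2 * real d2) \<le> r"
    and "(2 * real d2 - 1 - sqrt (1 + 4 * real d1 * real d2)) /
           (2 * real d2 + 1 + sqrt (1 + 4 * real d1 * real d2)) \<le> r"
    using radius_bounds[OF _ _ r0 r lo hi] d2 by simp_all
qed

section \<open>The Koebe function as a conformal map onto a slit plane\<close>

text \<open>The principal root recovers the Cayley transform \<open>(1 + z) / (1 - z)\<close> of the
  preimage \<open>z\<close>, and \<open>(s - 1) / (s + 1)\<close> inverts that transform.\<close>

definition koebe_inv :: "complex \<Rightarrow> complex" where
  "koebe_inv w = (csqrt (1 + 4 * w) - 1) / (csqrt (1 + 4 * w) + 1)"

text \<open>This factors \<open>koebe\<close> through the right half-plane: Cayley transform,
  squaring, then an affine map.\<close>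

lemma koebe_Cayley:
  assumes "z \<in> ball 0 1"
  shows "1 + 4 * koebe z = ((1 + z) / (1 - z))\<^sup>2" and "0 < Re ((1 + z) / (1 - z))"
proof -
  have ne: "1 - z \<noteq> 0" using assms by auto
  have "1 + 4 * koebe z = ((1 - z)\<^sup>2 + 4 * z) / (1 - z)\<^sup>2"
    using ne by (simp add: koebe_def add_divide_distrib)
  also have "(1 - z)\<^sup>2 + 4 * z = (1 + z)\<^sup>2" by (simp add: power2_eq_square algebra_simps)
  finally show "1 + 4 * koebe z = ((1 + z) / (1 - z))\<^sup>2" by (simp add: power_divide)
  have "1 / 2 > Re (z / (z - 1))" using assms by (intro Re_divide_diff_unit_circle) auto
  moreover have "(1 + z) / (1 - z) = 1 - (z / (z - 1) + z / (z - 1))" using ne by (simp add: divide_simps) algebra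
  ultimately show "0 < Re ((1 + z) / (1 - z))" by (simp only: minus_complex.simps plus_complex.simps one_complex.simps)
qed

lemma koebe_inv_koebe: "z \<in> ball 0 1 \<Longrightarrow> koebe_inv (koebe z) = z"
proof -
  assume z: "z \<in> ball 0 1"
  then have ne: "1 - z \<noteq> 0" by auto
  have "csqrt (1 + 4 * koebe z) = (1 + z) / (1 - z)"
    unfolding koebe_Cayley(1)[OF z] using koebe_Cayley(2)[OF z] by (intro csqrt_square) simp
  moreover have "(1 + z) / (1 - z) - 1 = 2 * z / (1 - z)" "(1 + z) / (1 - z) + 1 = 2 / (1 - z)"
    using ne by (simp_all add: field_simps)
  ultimately show ?thesis using ne by (simp add: koebe_inv_def)
qed

lemma koebe_notin_slit:
  assumes "z \<in> ball 0 1"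
  shows "1 + 4 * koebe z \<notin> \<real>\<^sub>\<le>\<^sub>0"
proof -
  define u where "u = (1 + z) / (1 - z)"
  have u: "0 < Re u" "1 + 4 * koebe z = u\<^sup>2" using koebe_Cayley[OF assms] by (simp_all add: u_def)
  show ?thesis unfolding u(2) using u(1)
    by (auto simp: complex_nonpos_Reals_iff power2_eq_square mult_le_0_iff)
qed

text \<open>Off the slit, the principal root \<open>s\<close> of \<open>1 + 4 * w\<close> has
  strictly positive real part, so it is closer to 1 than to -1; this puts \<open>koebe_inv w\<close>
  in the disk.\<close>

lemma koebe_koebe_inv:
  assumes "1 + 4 * w \<notin> \<real>\<^sub>\<le>\<^sub>0"
  shows "koebe_inv w \<in> ball 0 1" and "koebe (koebe_inv w) = w"
proof -
  define s where "s = csqrt (1 + 4 * w)"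
  have s2: "s\<^sup>2 = 1 + 4 * w" by (simp add: s_def)
  have "Re s \<ge> 0" unfolding s_def by (rule Re_csqrt)
  moreover have "Re s \<noteq> 0"
  proof
    assume "Re s = 0"
    then have "s\<^sup>2 \<in> \<real>\<^sub>\<le>\<^sub>0" by (simp add: complex_nonpos_Reals_iff power2_eq_square)
    then show False using assms s2 by simp
  qed
  ultimately have s: "Re s > 0" by simp
  then have ne: "s + 1 \<noteq> 0" by (auto simp: complex_eq_iff)
  have h: "koebe_inv w = (s - 1) / (s + 1)" by (simp add: koebe_inv_def s_def)
  have "(cmod (s - 1))\<^sup>2 < (cmod (s + 1))\<^sup>2"
    unfolding cmod_power2 using s by (simp add: power2_eq_square algebra_simps)
  then have "cmod (s - 1) < cmod (s + 1)" by (rule power2_less_imp_less) simp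
  then show "koebe_inv w \<in> ball 0 1" using ne by (simp add: h norm_divide)
  have "1 - (s - 1) / (s + 1) = 2 / (s + 1)" using ne by (simp add: field_simps)
  then have "koebe (koebe_inv w) = (s - 1) / (s + 1) / (2 / (s + 1))\<^sup>2"
    by (simp only: koebe_def h)
  also have "\<dots> = (s - 1) * (s + 1) / 4"
    using ne by (simp add: power2_eq_square)
  also have "(s - 1) * (s + 1) = s\<^sup>2 - 1" by (simp add: power2_eq_square algebra_simps)
  finally show "koebe (koebe_inv w) = w" by (simp add: s2)
qed

lemma inj_on_koebe: "inj_on koebe (ball 0 1)"
  by (metis inj_onI koebe_inv_koebe)

lemma koebe_image: "koebe ` ball 0 1 = {w. 1 + 4 * w \<notin> \<real>\<^sub>\<le>\<^sub>0}"
  using koebe_notin_slit koebe_koebe_inv by (force simp: image_iff)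

lemma inv_into_koebe:
  assumes "1 + 4 * w \<notin> \<real>\<^sub>\<le>\<^sub>0"
  shows "inv_into (ball 0 1) koebe w = koebe_inv w"
  using koebe_koebe_inv[OF assms] by (rule inv_into_f_eq[OF inj_on_koebe])

text \<open>The image is the complement of the closed ray from \<open>-1/4\<close> to the left. That
  ray lies in the real axis, so its interior is empty and it is its own frontier.\<close>

lemma polygonal_boundary_koebe: "polygonal_boundary (koebe ` ball 0 1)"
proof -
  define S :: "complex set" where "S = {w. Im w = 0 \<and> Re w \<le> - 1 / 4}"
  have img: "koebe ` ball 0 1 = - S"
    unfolding koebe_image S_def by (auto simp: complex_nonpos_Reals_iff)
  have "closed S" unfolding S_def
    by (intro closed_Collect_conj closed_Collect_eq closed_Collect_le continuous_intros)
  moreover have "interior S = {}"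
  proof -
    have "interior S \<subseteq> interior {w. \<i> \<bullet> w = 0}"
      by (intro interior_mono) (auto simp: S_def inner_complex_def)
    also have "\<dots> = {}" by (rule interior_hyperplane) simp
    finally show ?thesis by blast
  qed
  ultimately have "frontier S = S" by (simp add: frontier_def closure_closed)
  then have "frontier (koebe ` ball 0 1) = S" by (simp only: img frontier_complement)
  moreover have "is_ray S"
  proof -
    have "S = {-1/4 + of_real t * (-1) |t. 0 \<le> t}"
    proof (intro set_eqI iffI)
      fix w assume "w \<in> S"
      then have "w = -1/4 + of_real (- 1 / 4 - Re w) * (-1)" "0 \<le> - 1 / 4 - Re w"
        by (auto simp: S_def complex_eq_iff)
      then show "w \<in> {-1/4 + of_real t * (-1) |t. 0 \<le> t}" by blast
    qed (auto simp: S_def)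
    then show ?thesis unfolding is_ray_def by (intro exI[of _ "-1/4"] exI[of _ "-1"]) simp
  qed
  ultimately show ?thesis unfolding polygonal_boundary_def by (intro exI[of _ "{S}"]) simp
qed

section \<open>Interior angles of the Koebe function at its two vertices\<close>

lemma sin_eq_0_cases:
  assumes "0 \<le> \<theta>" "\<theta> < 2 * pi" "sin \<theta> = 0"
  shows "\<theta> = 0 \<or> \<theta> = pi"
proof (rule ccontr)
  assume "\<not> ?thesis"
  then consider "0 < \<theta>" "\<theta> < pi" | "pi < \<theta>" using assms(1) by linarith
  then show False
    by cases (use assms(2,3) sin_gt_zero[of \<theta>] sin_lt_zero[of \<theta>] in simp_all)
qed

lemma opening_angle_koebeI:
  assumes F: "F \<noteq> bot"
    and slit: "\<forall>\<^sub>F \<rho> in F. 1 + 4 * (w - of_real \<rho>) \<in> \<real>\<^sub>\<le>\<^sub>0"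
    and off: "\<And>\<theta>. 0 \<le> \<theta> \<Longrightarrow> \<theta> < 2 * pi \<Longrightarrow> \<theta> \<noteq> pi \<Longrightarrow>
               \<forall>\<^sub>F \<rho> in F. 1 + 4 * (w + of_real \<rho> * cis \<theta>) \<notin> \<real>\<^sub>\<le>\<^sub>0"
    and lim: "\<And>\<theta>. ((\<lambda>\<rho>. koebe_inv (w + of_real \<rho> * cis \<theta>)) \<longlongrightarrow> \<zeta>) F"
  shows "opening_angle koebe \<zeta> w F = 2 * pi"
proof -
  have "{\<theta>\<in>{0..<2 * pi}.
          (\<forall>\<^sub>F \<rho> in F. w + of_real \<rho> * cis \<theta> \<in> koebe ` ball 0 1) \<and>
          ((\<lambda>\<rho>. inv_into (ball 0 1) koebe (w + of_real \<rho> * cis \<theta>)) \<longlongrightarrow> \<zeta>) F}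
        = {0..<2 * pi} - {pi}" (is "?A = _")
  proof (intro set_eqI iffI)
    fix \<theta> assume \<theta>: "\<theta> \<in> ?A"
    have "\<theta> \<noteq> pi"
    proof
      assume "\<theta> = pi"
      then have "\<forall>\<^sub>F \<rho> in F. 1 + 4 * (w - of_real \<rho>) \<notin> \<real>\<^sub>\<le>\<^sub>0"
        using \<theta> by (simp add: koebe_image)
      then have "\<forall>\<^sub>F \<rho> in F. False" using slit by eventually_elim simp
      then show False using F by simp
    qed
    then show "\<theta> \<in> {0..<2 * pi} - {pi}" using \<theta> by simp
  next
    fix \<theta> assume \<theta>: "\<theta> \<in> {0..<2 * pi} - {pi}"
    then have ev: "\<forall>\<^sub>F \<rho> in F. 1 + 4 * (w + of_real \<rho> * cis \<theta>) \<notin> \<real>\<^sub>\<le>\<^sub>0"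
      using off by simp
    have "((\<lambda>\<rho>. inv_into (ball 0 1) koebe (w + of_real \<rho> * cis \<theta>)) \<longlongrightarrow> \<zeta>) F"
      by (rule Lim_transform_eventually[OF lim[of \<theta>]])
        (use ev in eventually_elim, simp add: inv_into_koebe)
    then show "\<theta> \<in> ?A" using ev \<theta> by (simp add: koebe_image)
  qed
  then have "opening_angle koebe \<zeta> w F = measure lebesgue ({0..<2 * pi} - {pi})"
    by (simp add: opening_angle_def)
  also have "\<dots> = measure lebesgue {0..<2 * pi}"
    by (intro measure_Diff_null_set) auto
  finally show ?thesis by simp
qed

lemma has_interior_angle_koebe_minus_1: "has_interior_angle koebe (-1) (2 * pi)"
proof -
  have "(koebe \<longlongrightarrow> -1/4) (at (-1) within ball 0 1)"
  proof -
    have "((\<lambda>z::complex. z / (1 - z)\<^sup>2) \<longlongrightarrow> (-1) / (1 - (-1))\<^sup>2) (at (-1) within ball 0 1)"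
      by (intro tendsto_intros) auto
    then show ?thesis by (simp add: koebe_def[abs_def])
  qed
  moreover have "opening_angle koebe (-1) (-1/4) (at_right 0) = 2 * pi"
  proof (rule opening_angle_koebeI)
    show "\<forall>\<^sub>F \<rho> in at_right 0. 1 + 4 * (-1/4 - complex_of_real \<rho>) \<in> \<real>\<^sub>\<le>\<^sub>0"
      using eventually_at_right_less[of "0 :: real"]
      by eventually_elim (simp add: complex_nonpos_Reals_iff)
  next
    fix \<theta> :: real assume "0 \<le> \<theta>" "\<theta> < 2 * pi" "\<theta> \<noteq> pi"
    then show "\<forall>\<^sub>F \<rho> in at_right 0. 1 + 4 * (-1/4 + of_real \<rho> * cis \<theta>) \<notin> \<real>\<^sub>\<le>\<^sub>0"
      using eventually_at_right_less[of "0 :: real"]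
      by (auto elim!: eventually_mono simp: complex_nonpos_Reals_iff dest!: sin_eq_0_cases)
  next
    fix \<theta> :: real
    \<comment> \<open>At the tip \<open>1 + 4 * (-1/4)\<close> cancels, so the modulus of the root
      is \<open>sqrt (4 * \<bar>\<rho>\<bar>)\<close> in every direction.\<close>
    have "((\<lambda>\<rho>. sqrt (4 * \<bar>\<rho>\<bar>)) \<longlongrightarrow> sqrt (4 * \<bar>0\<bar>)) (at_right 0)"
      by (intro tendsto_intros)
    then have "((\<lambda>\<rho>. cmod (csqrt (1 + 4 * (-1/4 + of_real \<rho> * cis \<theta>)))) \<longlongrightarrow> 0) (at_right 0)"
      by (simp add: norm_mult)
    then have "((\<lambda>\<rho>. csqrt (1 + 4 * (-1/4 + of_real \<rho> * cis \<theta>))) \<longlongrightarrow> 0) (at_right 0)"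
      by (rule tendsto_norm_zero_cancel)
    then have "((\<lambda>\<rho>. koebe_inv (-1/4 + of_real \<rho> * cis \<theta>)) \<longlongrightarrow> (0 - 1) / (0 + 1)) (at_right 0)"
      unfolding koebe_inv_def by (intro tendsto_intros) auto
    then show "((\<lambda>\<rho>. koebe_inv (-1/4 + of_real \<rho> * cis \<theta>)) \<longlongrightarrow> -1) (at_right 0)" by simp
  qed simp
  ultimately show ?thesis unfolding has_interior_angle_def by metis
qed

lemma has_interior_angle_koebe_1: "has_interior_angle koebe 1 (- (2 * pi))"
proof -
  have "filterlim koebe at_infinity (at 1 within ball 0 1)"
    unfolding koebe_def[abs_def]
  proof (rule filterlim_divide_at_infinity)
    have "((\<lambda>z::complex. (1 - z)\<^sup>2) \<longlongrightarrow> (1 - 1)\<^sup>2) (at 1 within ball 0 1)"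
      by (intro tendsto_intros)
    then show "filterlim (\<lambda>z::complex. (1 - z)\<^sup>2) (at 0) (at 1 within ball 0 1)"
      by (auto simp: filterlim_at eventually_at_filter)
  qed (auto intro: tendsto_intros)
  moreover have "opening_angle koebe 1 0 at_top = 2 * pi"
  proof (rule opening_angle_koebeI)
    show "\<forall>\<^sub>F \<rho> in at_top. 1 + 4 * (0 - complex_of_real \<rho>) \<in> \<real>\<^sub>\<le>\<^sub>0"
      using eventually_ge_at_top[of "1 :: real"]
      by eventually_elim (simp add: complex_nonpos_Reals_iff)
  next
    fix \<theta> :: real assume "0 \<le> \<theta>" "\<theta> < 2 * pi" "\<theta> \<noteq> pi"
    then have "\<theta> = 0 \<or> sin \<theta> \<noteq> 0" using sin_eq_0_cases by blast
    then show "\<forall>\<^sub>F \<rho> in at_top. 1 + 4 * (0 + of_real \<rho> * cis \<theta>) \<notin> \<real>\<^sub>\<le>\<^sub>0"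
      by (intro eventually_mono[OF eventually_ge_at_top[of 1]]) (auto simp: complex_nonpos_Reals_iff)
  next
    fix \<theta> :: real
    have "filterlim (\<lambda>\<rho>::real. 4 * \<rho>) at_top at_top"
      by (rule filterlim_tendsto_pos_mult_at_top[OF tendsto_const _ filterlim_ident]) simp
    moreover have "\<forall>\<^sub>F \<rho> in at_top. 4 * \<rho> = norm (4 * (of_real \<rho> * cis \<theta>))"
      using eventually_ge_at_top[of "0 :: real"] by eventually_elim (simp add: norm_mult)
    ultimately have "filterlim (\<lambda>\<rho>. norm (4 * (of_real \<rho> * cis \<theta>))) at_top at_top"
      by (rule filterlim_cong[THEN iffD1, OF refl refl, rotated])
    then have "filterlim (\<lambda>\<rho>. 4 * (of_real \<rho> * cis \<theta>)) at_infinity at_top"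
      by (rule filterlim_norm_at_top_imp_at_infinity)
    then have "filterlim (\<lambda>\<rho>. 1 + 4 * (0 + of_real \<rho> * cis \<theta>)) at_infinity at_top"
      by (simp add: tendsto_add_filterlim_at_infinity[OF tendsto_const])
    then have "filterlim (\<lambda>\<rho>. norm (1 + 4 * (0 + of_real \<rho> * cis \<theta>))) at_top at_top"
      by (rule filterlim_at_infinity_imp_norm_at_top)
    then have "filterlim (\<lambda>\<rho>. norm (csqrt (1 + 4 * (0 + of_real \<rho> * cis \<theta>)))) at_top at_top"
      unfolding norm_csqrt by (rule filterlim_compose[OF sqrt_at_top])
    then have "filterlim (\<lambda>\<rho>. csqrt (1 + 4 * (0 + of_real \<rho> * cis \<theta>))) at_infinity at_top"
      by (rule filterlim_norm_at_top_imp_at_infinity)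
    then have inf: "filterlim (\<lambda>\<rho>. csqrt (1 + 4 * (0 + of_real \<rho> * cis \<theta>)) + 1) at_infinity at_top"
      by (rule tendsto_add_filterlim_at_infinity'[OF _ tendsto_const])
    \<comment> \<open>The inverse is rewritten as \<open>1 - 2 / (s + 1)\<close>, so that
      \<open>s\<close> tending to infinity gives the limit 1.\<close>
    have "((\<lambda>\<rho>. 1 - 2 / (csqrt (1 + 4 * (0 + of_real \<rho> * cis \<theta>)) + 1)) \<longlongrightarrow> 1 - 0) at_top"
      by (intro tendsto_diff tendsto_const tendsto_divide_0[OF tendsto_const inf])
    moreover have "koebe_inv w = 1 - 2 / (csqrt (1 + 4 * w) + 1)" for w
    proof -
      have "Re (csqrt (1 + 4 * w) + 1) > 0"
        using Re_csqrt[of "1 + 4 * w"] unfolding plus_complex.simps one_complex.simps by linarith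
      then have "csqrt (1 + 4 * w) + 1 \<noteq> 0" by (metis less_irrefl zero_complex.simps(1))
      then show ?thesis by (simp add: koebe_inv_def field_simps)
    qed
    ultimately show "((\<lambda>\<rho>. koebe_inv (0 + of_real \<rho> * cis \<theta>)) \<longlongrightarrow> 1) at_top"
      by (simp only: diff_0_right)
  qed simp
  ultimately show ?thesis unfolding has_interior_angle_def by metis
qed

section \<open>Schwarz-Christoffel data and Blaschke representation of the Koebe function\<close>

lemma koebe_pre_Schwarzian:
  assumes "z \<in> ball 0 1"
  shows "deriv (deriv koebe) z / deriv koebe z = (4 + 2 * z) / ((1 - z) * (1 + z))"
proof -
  have ne: "1 - z \<noteq> 0" "1 + z \<noteq> 0" if "z \<in> ball 0 1" for z :: complex
    using that by (auto simp: add_eq_0_iff)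
  have D: "deriv koebe z = (1 + z) / (1 - z) ^ 3" if "z \<in> ball 0 1" for z
  proof -
    have "(koebe has_field_derivative
        (1 * (1 - z)\<^sup>2 - z * (2 * (1 - z) * (-1))) / ((1 - z)\<^sup>2 * (1 - z)\<^sup>2)) (at z)"
      unfolding koebe_def[abs_def] using ne[OF that] by (auto intro!: derivative_eq_intros)
    moreover have "1 * (1 - z)\<^sup>2 - z * (2 * (1 - z) * (-1)) = (1 - z) * (1 + z)" by algebra
    moreover have "(1 - z)\<^sup>2 * (1 - z)\<^sup>2 = (1 - z) * (1 - z) ^ 3" by algebra
    ultimately show ?thesis using ne[OF that] by (intro DERIV_imp_deriv) simp
  qed
  have "((\<lambda>z. (1 + z) / (1 - z) ^ 3) has_field_derivative
      (1 * (1 - z) ^ 3 - (1 + z) * (3 * (1 - z)\<^sup>2 * (-1))) / ((1 - z) ^ 3 * (1 - z) ^ 3)) (at z)"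
    using ne[OF assms] by (auto intro!: derivative_eq_intros)
  moreover have "1 * (1 - z) ^ 3 - (1 + z) * (3 * (1 - z)\<^sup>2 * (-1)) = (1 - z)\<^sup>2 * (4 + 2 * z)"
    by algebra
  moreover have "(1 - z) ^ 3 * (1 - z) ^ 3 = (1 - z)\<^sup>2 * (1 - z) ^ 4" by algebra
  moreover have "(1 - z)\<^sup>2 * (4 + 2 * z) / ((1 - z)\<^sup>2 * (1 - z) ^ 4) = (4 + 2 * z) / (1 - z) ^ 4"
    using ne[OF assms] by (intro nonzero_mult_divide_mult_cancel_left) simp
  ultimately have "((\<lambda>z. (1 + z) / (1 - z) ^ 3) has_field_derivative
      (4 + 2 * z) / (1 - z) ^ 4) (at z)"
    by (simp only:)
  have "deriv (deriv koebe) z = deriv (\<lambda>z. (1 + z) / (1 - z) ^ 3) z"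
    using assms D by (intro deriv_cong_ev eventually_mono[OF eventually_nhds_in_open[of "ball 0 1"]]) auto
  also have "\<dots> = (4 + 2 * z) / (1 - z) ^ 4" by (rule DERIV_imp_deriv) fact
  finally have "deriv (deriv koebe) z = (4 + 2 * z) / (1 - z) ^ 4" .
  moreover have "A / d ^ 4 / (B / d ^ 3) = A / (d * B)" if "d \<noteq> 0" for A B d :: complex
    using that by (simp add: power4_eq_xxxx power3_eq_cube)
  ultimately show ?thesis using D[OF assms] ne(1)[OF assms] by simp
qed

lemma schwarz_christoffel_mapping_koebe: "schwarz_christoffel_mapping koebe 2"
  unfolding schwarz_christoffel_mapping_def
proof (intro conjI exI)
  \<comment> \<open>The tip of the slit has preimage -1 and angle \<open>2 * pi\<close>, giving
    exponent \<open>- 1 / 2\<close>; infinity has preimage 1 and angle \<open>- 2 * pi\<close>,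
    giving \<open>3 / 2\<close>.\<close>
  define z :: "nat \<Rightarrow> complex" where "z = (\<lambda>k. if k = 1 then -1 else 1)"
  define \<beta> :: "nat \<Rightarrow> real" where "\<beta> = (\<lambda>k. if k = 1 then -1/2 else 3/2)"
  have I: "{1..2} = {1, 2 :: nat}" by auto
  show "koebe holomorphic_on ball 0 1"
    unfolding koebe_def[abs_def] by (intro holomorphic_intros) auto
  show "inj_on koebe (ball 0 1)" by (rule inj_on_koebe)
  show "polygonal_boundary (koebe ` ball 0 1)" by (rule polygonal_boundary_koebe)
  show "inj_on z {1..2}" unfolding I by (simp add: z_def)
  show "(\<Sum>k=1..2. \<beta> k) = 1" unfolding I by (simp add: \<beta>_def)
  have "\<exists>\<alpha>. has_interior_angle koebe (z k) \<alpha> \<and> 2 * pi * \<beta> k = pi - \<alpha>" for k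
    using has_interior_angle_koebe_1 has_interior_angle_koebe_minus_1
    by (cases "k = 1") (auto simp: z_def \<beta>_def)
  then show "\<forall>k\<in>{1..2}. cmod (z k) = 1 \<and> \<beta> k \<noteq> 0 \<and>
      (\<exists>\<alpha>. has_interior_angle koebe (z k) \<alpha> \<and> 2 * pi * \<beta> k = pi - \<alpha>)"
    by (simp add: z_def \<beta>_def)
  show "\<forall>\<zeta>\<in>ball 0 1. deriv (deriv koebe) \<zeta> / deriv koebe \<zeta> =
      - 2 * (\<Sum>k=1..2. of_real (\<beta> k) / (\<zeta> - z k))"
  proof
    fix \<zeta> :: complex assume \<zeta>: "\<zeta> \<in> ball 0 1"
    then have ne: "1 - \<zeta> \<noteq> 0" "1 + \<zeta> \<noteq> 0" by (auto simp: add_eq_0_iff)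
    \<comment> \<open>Partial fractions: \<open>4 + 2 * \<zeta> = u + 3 * v\<close> for
      \<open>u = 1 - \<zeta>\<close> and \<open>v = 1 + \<zeta>\<close>.\<close>
    have "(u + 3 * v) / (u * v) = 1 / v + 3 / u" if "u \<noteq> 0" "v \<noteq> 0" for u v :: complex
      using that by (simp add: add_divide_distrib)
    from this[OF ne] have "(4 + 2 * \<zeta>) / ((1 - \<zeta>) * (1 + \<zeta>)) = 1 / (1 + \<zeta>) + 3 / (1 - \<zeta>)"
      by (simp add: algebra_simps)
    moreover have "3 / (1 - \<zeta>) = - (3 / (\<zeta> - 1))"
      by (metis minus_diff_eq minus_divide_right)
    moreover have "(\<Sum>k=1..2. of_real (\<beta> k) / (\<zeta> - z k)) =
        of_real (- 1 / 2) / (1 + \<zeta>) + of_real (3 / 2) / (\<zeta> - 1)"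
      unfolding I by (simp add: z_def \<beta>_def add.commute)
    moreover have "- 2 * (of_real (- 1 / 2) / x + of_real (3 / 2) / y) = 1 / x - 3 / y" for x y :: complex
      by (cases "x = 0"; cases "y = 0") (simp_all add: field_simps)
    ultimately show "deriv (deriv koebe) \<zeta> / deriv koebe \<zeta> = - 2 * (\<Sum>k=1..2. of_real (\<beta> k) / (\<zeta> - z k))"
      unfolding koebe_pre_Schwarzian[OF \<zeta>] by (simp only: diff_conv_add_uminus)
  qed
qed

lemma koebe_extremal:
  "\<exists>B1 B2.
      finite_blaschke_product B1 0 \<and> finite_blaschke_product B2 1 \<and>
      blaschke_zeros B1 \<inter> blaschke_zeros B2 = {} \<and>
      blaschke_representation koebe B1 B2 \<and>
      blaschke_zeros B1 \<union> blaschke_zeros B2 \<subseteq> cball 0 (1 / 2)"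
proof (intro exI conjI)
  \<comment> \<open>Solving \<open>f'' / f' = 2 * B / (1 - z * B)\<close> for \<open>B\<close> with
    \<open>f = koebe\<close> gives \<open>B = (2 + z) / (1 + 2 * z)\<close>. This is the reciprocal
    of a single Blaschke factor with zero \<open>- 1 / 2\<close>.\<close>
  define B2 :: "complex \<Rightarrow> complex" where "B2 = (\<lambda>z. (z + 1 / 2) / (1 + z / 2))"
  have ne: "1 + z / 2 \<noteq> 0" if "z \<in> ball 0 1" for z :: complex
  proof
    assume "1 + z / 2 = 0"
    then have "1 = - (z / 2)" by (simp only: eq_neg_iff_add_eq_0)
    then have "cmod 1 = cmod (- (z / 2))" by (rule arg_cong)
    then show False using that by (simp add: norm_divide)
  qed
  show "finite_blaschke_product (\<lambda>_. 1) 0"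
    unfolding finite_blaschke_product_def by (intro exI[of _ 1]) auto
  show "finite_blaschke_product B2 1"
    unfolding finite_blaschke_product_def B2_def by (intro exI[of _ 1] exI[of _ "\<lambda>_. -1/2"]) simp
  show "blaschke_zeros (\<lambda>_. 1) \<inter> blaschke_zeros B2 = {}" by (simp add: blaschke_zeros_def)
  show "blaschke_zeros (\<lambda>_. 1) \<union> blaschke_zeros B2 \<subseteq> cball 0 (1 / 2)"
    using ne by (auto simp: blaschke_zeros_def B2_def add_eq_0_iff2 norm_divide)
  show "blaschke_representation koebe (\<lambda>_. 1) B2"
    unfolding blaschke_representation_def
  proof (intro ballI impI)
    fix z :: complex assume z: "z \<in> ball 0 1" and nz: "B2 z \<noteq> 0"
    have n: "1 - z \<noteq> 0" "1 + z \<noteq> 0" using z by (auto simp: add_eq_0_iff)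
    have eq: "2 + z = 2 * (1 + z / 2)" "1 + 2 * z = 2 * (z + 1 / 2)" by simp_all
    have "z + 1 / 2 \<noteq> 0" using nz by (auto simp: B2_def)
    then have n2: "2 + z \<noteq> 0" "1 + 2 * z \<noteq> 0"
      unfolding eq by (intro no_zero_divisors ne[OF z]; simp)+
    have "B2 z = (1 + 2 * z) / (2 + z)"
      unfolding eq B2_def by (rule mult_divide_mult_cancel_left[symmetric]) simp
    then have "1 / B2 z = (2 + z) / (1 + 2 * z)" by simp
    moreover have "1 - z * ((2 + z) / (1 + 2 * z)) = (1 - z) * (1 + z) / (1 + 2 * z)"
      using n2 by (simp add: field_simps)
    ultimately show "deriv (deriv koebe) z / deriv koebe z = 2 * (1 / B2 z) / (1 - z * (1 / B2 z))"
      unfolding koebe_pre_Schwarzian[OF z] using n n2 by simp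
  qed
qed

section \<open>The general bounds, the case \<open>d2 = 1\<close> and sharpness\<close>

theorem theorem9:
  "(\<forall>(f :: complex \<Rightarrow> complex) (B1 :: complex \<Rightarrow> complex) (B2 :: complex \<Rightarrow> complex)
      (n :: nat) (d1 :: nat) (d2 :: nat) (r :: real).
      schwarz_christoffel_mapping f (n + 1) \<and>
      finite_blaschke_product B1 d1 \<and> finite_blaschke_product B2 d2 \<and>
      blaschke_zeros B1 \<inter> blaschke_zeros B2 = {} \<and>
      d1 + d2 = n \<and> d2 \<ge> 1 \<and>
      blaschke_representation f B1 B2 \<and>
      r < 1 \<and> blaschke_zeros B1 \<union> blaschke_zeros B2 \<subseteq> cball 0 r
      \<longrightarrow>
      r \<ge> max
        ((sqrt (4 * real d1 * real d2 + 9) + 3 - 2 * real d2) /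
         (sqrt (4 * real d1 * real d2 + 9) + 3 + 2 * real d2))
        ((2 * real d2 - 1 - sqrt (1 + 4 * real d1 * real d2)) /
         (2 * real d2 + 1 + sqrt (1 + 4 * real d1 * real d2))) \<and>
      (d2 = 1 \<longrightarrow>
        r \<ge> (sqrt (4 * real n + 5) + 1) / (sqrt (4 * real n + 5) + 5) \<and>
        (sqrt (4 * real n + 5) + 1) / (sqrt (4 * real n + 5) + 5) \<ge> 1 / 2))
   \<and>
   (\<exists>B1 B2.
      schwarz_christoffel_mapping koebe (1 + 1) \<and>
      finite_blaschke_product B1 0 \<and> finite_blaschke_product B2 1 \<and>
      blaschke_zeros B1 \<inter> blaschke_zeros B2 = {} \<and>
      blaschke_representation koebe B1 B2 \<and>
      blaschke_zeros B1 \<union> blaschke_zeros B2 \<subseteq> cball 0 (1 / 2) \<and>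
      (sqrt (4 * real 1 + 5) + 1) / (sqrt (4 * real 1 + 5) + 5) = 1 / 2)"
proof (intro conjI allI impI, goal_cases)
  case (1 f B1 B2 n d1 d2 r)
  then show ?case
    using schwarz_christoffel_radius_bounds[of f "n + 1" B1 d1 B2 d2 r] by simp
next
  case (2 f B1 B2 n d1 d2 r)
  \<comment> \<open>For \<open>d2 = 1\<close> one has \<open>d1 = n - 1\<close>, so the first
    general bound specializes to the claim.\<close>
  then have "4 * real n + 5 = 4 * real d1 * real d2 + 9" by auto
  moreover have "(sqrt (4 * real d1 * real d2 + 9) + 3 - 2 * real d2) /
      (sqrt (4 * real d1 * real d2 + 9) + 3 + 2 * real d2) \<le> r"
    using 2 schwarz_christoffel_radius_bounds(1)[of f "n + 1" B1 d1 B2 d2 r] by blast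
  ultimately show ?case using 2(2) by (simp add: ac_simps)
next
  case (3 f B1 B2 n d1 d2 r)
  then have "n \<ge> 1" by auto
  \<comment> \<open>With \<open>s\<close> for the root, \<open>(s + 1) / (s + 5) \<ge> 1 / 2\<close>
    amounts to \<open>s \<ge> 3\<close>, with equality at \<open>n = 1\<close>.\<close>
  then have "3 \<le> sqrt (4 * real n + 5)" by (intro real_le_rsqrt) simp
  then show ?case by (simp add: divide_simps)
next
  case 4
  have "sqrt (4 * real 1 + 5) = 3" by (rule real_sqrt_unique) auto
  then show ?case using koebe_extremal schwarz_christoffel_mapping_koebe by (auto simp: numeral_2_eq_2)
qed

end
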